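(* Consider the weighted Tower of Hanoi on three pegs $\{1,2,3\}$ with nonnegative move costs $w_{ab}$ ($a\neq b$). For distinct pegs $i,j$ let $k=6-i-j$ be the third peg, and let $C_n^{i,j}$ denote the minimum total cost of a legal sequence of moves transferring a tower of $n$ discs from peg $i$ to peg $j$ (with $C_0^{i,j}=0$). Then for all $n\in\mathbb{N}$, $n\ge 1$, $$C_{n}^{i,j}=\begin{cases}\min\{w_{ij},\,w_{ik}+w_{kj}\} & \text{if } n=1,\\ \min\{C_{n-1}^{i,k}+C_{n-1}^{k,j}+w_{ij},\ 2C_{n-1}^{i,j}+C_{n-1}^{j,i}+w_{ik}+w_{kj}\} & \text{if } n\ge 2.\end{cases}$$
   Context: Weighted Tower of Hanoi (WTH): there are three pegs labelled $1,2,3$ and $n\in\mathbb{N}_0$ discs of pairwise distinct diameters. A state assigns each disc to a peg; on each peg the discs are stacked with diameters decreasing from bottom to top. A (legal) move takes the topmost disc of some peg $a$ and places it on a different peg $b$, provided $b$ is empty or its topmost disc is larger than the moved disc; such a move costs $w_{ab}$, where $(w_{ab})_{a\neq b}$ are given nonnegative reals. An instance is given by $n$, a source peg $i$ and a destination peg $j\neq i$: initially all $n$ discs are on peg $i$, and the goal is to have all $n$ discs on peg $j$. A solution is a finite sequence of legal moves from the initial to the goal state; its total cost is the sum of the costs of its moves; an optimal solution is one of minimum total cost. $C_n^{i,j}$ denotes the total cost of an optimal solution, and $C_0^{i,j}=0$. *)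

theory Defs
  imports Complex_Main "HOL-Library.FuncSet"
begin

definition pegs :: "nat set" where
  "pegs = {1, 2, 3}"

text \<open>The discs are numbered \<open>1, \<dots>, n\<close> by increasing diameter. As the order of the discs on each
  peg is forced, a state is just an assignment of discs to pegs; it is \<open>undefined\<close> outside
  \<open>{1..n}\<close>, so that equality of states is equality of functions.\<close>

definition states :: "nat \<Rightarrow> (nat \<Rightarrow> nat) set" where
  "states n = {1..n} \<rightarrow>\<^sub>E pegs"

definition tower :: "nat \<Rightarrow> nat \<Rightarrow> (nat \<Rightarrow> nat)" where
  "tower n p = (\<lambda>d\<in>{1..n}. p)"

definition discs_on :: "nat \<Rightarrow> (nat \<Rightarrow> nat) \<Rightarrow> nat \<Rightarrow> nat set" where
  "discs_on n s a = {d \<in> {1..n}. s d = a}"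

text \<open>Only meaningful if the peg is nonempty.\<close>

definition top_disc :: "nat \<Rightarrow> (nat \<Rightarrow> nat) \<Rightarrow> nat \<Rightarrow> nat" where
  "top_disc n s a = Min (discs_on n s a)"

definition legal_move :: "nat \<Rightarrow> (nat \<Rightarrow> nat) \<Rightarrow> nat \<Rightarrow> nat \<Rightarrow> (nat \<Rightarrow> nat) \<Rightarrow> bool" where
  "legal_move n s a b s' \<longleftrightarrow>
     s \<in> states n \<and> a \<in> pegs \<and> b \<in> pegs \<and> a \<noteq> b \<and>
     discs_on n s a \<noteq> {} \<and>
     (discs_on n s b = {} \<or> top_disc n s a < top_disc n s b) \<and>
     s' = s(top_disc n s a := b)"

text \<open>A move is recorded as the pair of its source and target peg, which determines the moved disc.\<close>

fun legal_moves :: "nat \<Rightarrow> (nat \<Rightarrow> nat) \<Rightarrow> (nat \<times> nat) list \<Rightarrow> (nat \<Rightarrow> nat) \<Rightarrow> bool" where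
  "legal_moves n s [] t \<longleftrightarrow> s = t"
| "legal_moves n s ((a, b) # ms) t \<longleftrightarrow> (\<exists>s'. legal_move n s a b s' \<and> legal_moves n s' ms t)"

definition cost :: "(nat \<Rightarrow> nat \<Rightarrow> real) \<Rightarrow> (nat \<times> nat) list \<Rightarrow> real" where
  "cost w ms = (\<Sum>(a, b)\<leftarrow>ms. w a b)"

definition solution :: "nat \<Rightarrow> nat \<Rightarrow> nat \<Rightarrow> (nat \<times> nat) list \<Rightarrow> bool" where
  "solution n i j ms \<longleftrightarrow> legal_moves n (tower n i) ms (tower n j)"

definition optimal_solution ::
    "(nat \<Rightarrow> nat \<Rightarrow> real) \<Rightarrow> nat \<Rightarrow> nat \<Rightarrow> nat \<Rightarrow> (nat \<times> nat) list \<Rightarrow> bool" where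
  "optimal_solution w n i j ms \<longleftrightarrow>
     solution n i j ms \<and> (\<forall>ms'. solution n i j ms' \<longrightarrow> cost w ms \<le> cost w ms')"

text \<open>Being a definite description, this is only determined once an optimal solution is known to
  exist; uniqueness of its cost is immediate.\<close>

definition opt_cost :: "(nat \<Rightarrow> nat \<Rightarrow> real) \<Rightarrow> nat \<Rightarrow> nat \<Rightarrow> nat \<Rightarrow> real" where
  "opt_cost w n i j = (THE c. \<exists>ms. optimal_solution w n i j ms \<and> c = cost w ms)"

lemma opt_cost_eqI:
  assumes "optimal_solution w n i j ms"
  shows "opt_cost w n i j = cost w ms"
  unfolding opt_cost_def
  by (rule the_equality) (use assms in \<open>auto simp: optimal_solution_def intro: order_antisym\<close>)

lemma cost_nonneg:
  assumes "\<And>a b. a \<in> pegs \<Longrightarrow> b \<in> pegs \<Longrightarrow> a \<noteq> b \<Longrightarrow> 0 \<le> w a b"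
    and "legal_moves n s ms t"
  shows "0 \<le> cost w ms"
  using assms(2)
proof (induction n s ms t rule: legal_moves.induct)
  case (2 n s a b ms t)
  then show ?case
    using assms(1)[of a b] by (auto simp: cost_def legal_move_def)
qed (simp add: cost_def)

lemma opt_cost_0:
  assumes "\<And>a b. a \<in> pegs \<Longrightarrow> b \<in> pegs \<Longrightarrow> a \<noteq> b \<Longrightarrow> 0 \<le> w a b"
  shows "opt_cost w 0 i j = 0"
proof -
  have "optimal_solution w 0 i j []"
    using cost_nonneg[of w] assms
    by (auto simp: optimal_solution_def solution_def tower_def cost_def[of _ "[]"])
  then show ?thesis
    by (simp add: opt_cost_eqI cost_def)
qed

end

theory Submission
  imports Defs
begin

text \<open>Whenever the largest disc moves, the other discs form a tower on the third peg.  If the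
  largest disc ever moves directly from \<open>i\<close> to \<open>j\<close>, then the smaller discs travel from \<open>i\<close> to \<open>k\<close>
  before and from \<open>k\<close> to \<open>j\<close> after that move.  Otherwise it leaves \<open>i\<close> for the last time towards
  \<open>k\<close> and next continues to \<open>j\<close>, and the smaller discs travel \<open>i \<rightarrow> j \<rightarrow> i \<rightarrow> j\<close> around these two
  moves.  Either way the cost is at least one of the two terms of the minimum, and both
  itineraries can be realised.  This also shows by induction that optimal solutions exist.\<close>

section \<open>Single moves, and the effect of adding a largest disc\<close>

text \<open>Being topmost on \<open>a\<close> and fitting on \<open>b\<close> both say that no disc
  smaller than the moved one lies there. This removes the minima and the split on whether
  \<open>b\<close> is empty, and shows that larger discs are irrelevant to legality.\<close>

lemma legal_move_iff:
  "legal_move n s a b s' \<longleftrightarrow>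
     s \<in> states n \<and> a \<in> pegs \<and> b \<in> pegs \<and> a \<noteq> b \<and>
     (\<exists>d\<in>{1..n}. s d = a \<and> (\<forall>e\<in>{1..<d}. s e \<noteq> a \<and> s e \<noteq> b) \<and> s' = s(d := b))"
    (is "_ \<longleftrightarrow> ?R")
proof -
  have fin: "finite (discs_on n s p)" for p
    by (simp add: discs_on_def)
  show ?thesis
  proof
    assume L: "legal_move n s a b s'"
    define d where "d = top_disc n s a"
    have "d \<in> discs_on n s a"
      using L fin unfolding d_def top_disc_def legal_move_def by (intro Min_in) auto
    then have d: "d \<in> {1..n}" "s d = a"
      by (auto simp: discs_on_def)
    have "s e \<noteq> a" "s e \<noteq> b" if e: "e \<in> {1..<d}" for e
    proof -
      have "d \<le> e" if "s e = a"
        unfolding d_def top_disc_def using that e d fin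
        by (intro Min_le) (auto simp: discs_on_def)
      then show "s e \<noteq> a"
        using e by auto
      show "s e \<noteq> b"
      proof
        assume "s e = b"
        then have eb: "e \<in> discs_on n s b"
          using e d by (auto simp: discs_on_def)
        then have "top_disc n s b \<le> e"
          unfolding top_disc_def using fin by (intro Min_le)
        moreover have "d < top_disc n s b"
          using L eb by (auto simp: legal_move_def d_def)
        ultimately show False
          using e by auto
      qed
    qed
    then show ?R
      using L d unfolding legal_move_def d_def[symmetric] by blast
  next
    assume ?R
    then obtain d where d: "s \<in> states n" "a \<in> pegs" "b \<in> pegs" "a \<noteq> b" "d \<in> {1..n}" "s d = a"
      "\<And>e. e \<in> {1..<d} \<Longrightarrow> s e \<noteq> a \<and> s e \<noteq> b" "s' = s(d := b)"
      by blast
    have min: "d \<le> e" if "e \<in> discs_on n s a \<union> discs_on n s b" for e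
      using that d(7)[of e] by (force simp: discs_on_def)
    have "d \<in> discs_on n s a"
      using d by (auto simp: discs_on_def)
    then have top: "top_disc n s a = d"
      unfolding top_disc_def using min fin by (intro Min_eqI) auto
    have "d < top_disc n s b" if "discs_on n s b \<noteq> {}"
    proof -
      have "top_disc n s b \<in> discs_on n s b"
        unfolding top_disc_def using that fin by (intro Min_in)
      then show ?thesis
        using min[of "top_disc n s b"] d by (fastforce simp: discs_on_def)
    qed
    then show "legal_move n s a b s'"
      using d top \<open>d \<in> discs_on n s a\<close> unfolding legal_move_def by auto
  qed
qed

lemma third_peg:
  assumes "i \<in> pegs" "j \<in> pegs" "i \<noteq> j" "k = 6 - i - j"
  shows "pegs = {i, j, k}" "k \<noteq> i" "k \<noteq> j"
proof -
  \<comment> \<open>The labels sum to 6. All six pairs are checked, so truncated subtraction is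
    harmless.\<close>
  have "(i, j, k) \<in> {(1, 2, 3), (1, 3, 2), (2, 1, 3), (2, 3, 1), (3, 1, 2), (3, 2, 1)}"
    using assms by (simp add: pegs_def) (elim disjE; simp)
  then show "pegs = {i, j, k}" "k \<noteq> i" "k \<noteq> j"
    by (auto simp: pegs_def)
qed

lemma tower_Suc: "tower (Suc n) p = (tower n p)(Suc n := p)"
  by (auto simp: tower_def restrict_def)

lemma restrict_tower_Suc: "restrict (tower (Suc n) p) {1..n} = tower n p"
  by (auto simp: tower_def restrict_def)

text \<open>Legality concerns only discs smaller than the moved one. So a move of a smaller disc
  survives forgetting the largest, while a move of the largest forces all others onto the third
  peg.\<close>

lemma legal_move_Suc_cases:
  assumes "legal_move (Suc n) s a b s'"
  obtains
    (small) "s' (Suc n) = s (Suc n)"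
      "legal_move n (restrict s {1..n}) a b (restrict s' {1..n})"
  | (large) c where "s (Suc n) = a" "s' (Suc n) = b" "pegs = {a, b, c}" "c \<noteq> a" "c \<noteq> b"
      "restrict s {1..n} = tower n c" "restrict s' {1..n} = tower n c"
proof -
  obtain d where d: "s \<in> states (Suc n)" "a \<in> pegs" "b \<in> pegs" "a \<noteq> b" "d \<in> {1..Suc n}" "s d = a"
    "\<forall>e\<in>{1..<d}. s e \<noteq> a \<and> s e \<noteq> b" "s' = s(d := b)"
    using assms unfolding legal_move_iff by blast
  show thesis
  proof (cases "d = Suc n")
    case True
    obtain c where c: "pegs = {a, b, c}" "c \<noteq> a" "c \<noteq> b"
      using third_peg[OF d(2-4) refl] by blast
    have "s e = c" if "e \<in> {1..n}" for e
    proof -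
      have "s e \<in> pegs"
        using d(1) that by (auto simp: states_def PiE_def Pi_def)
      then show ?thesis
        using d(7) True that c by auto
    qed
    then have "restrict s {1..n} = tower n c" "restrict s' {1..n} = tower n c"
      using d(8) True by (auto simp: tower_def restrict_def)
    then show thesis
      using d c True by (intro large) auto
  next
    case False
    have "restrict s {1..n} \<in> states n"
      using d(1) by (auto simp: states_def PiE_def Pi_def)
    moreover have "restrict s' {1..n} = (restrict s {1..n})(d := b)" "d \<in> {1..n}"
      using False d(5,8) by (auto simp: restrict_def)
    ultimately have "legal_move n (restrict s {1..n}) a b (restrict s' {1..n})"
      unfolding legal_move_iff using d by (auto intro!: bexI[of _ d])
    then show thesis
      using False d by (intro small) auto
  qed
qed

lemma legal_move_lift:
  assumes "legal_move n s a b s'" "p \<in> pegs"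
  shows "legal_move (Suc n) (s(Suc n := p)) a b (s'(Suc n := p))"
proof -
  obtain d where d: "s \<in> states n" "a \<in> pegs" "b \<in> pegs" "a \<noteq> b" "d \<in> {1..n}" "s d = a"
    "\<forall>e\<in>{1..<d}. s e \<noteq> a \<and> s e \<noteq> b" "s' = s(d := b)"
    using assms unfolding legal_move_iff by blast
  have "s(Suc n := p) \<in> states (Suc n)"
    using d(1) assms(2) by (auto simp: states_def PiE_def Pi_def extensional_def)
  then show ?thesis
    unfolding legal_move_iff using d by (auto intro!: bexI[of _ d])
qed

lemma legal_move_largest:
  assumes "a \<in> pegs" "b \<in> pegs" "c \<in> pegs" "a \<noteq> b" "c \<noteq> a" "c \<noteq> b"
  shows "legal_move (Suc n) ((tower n c)(Suc n := a)) a b ((tower n c)(Suc n := b))"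
  unfolding legal_move_iff
  using assms by (auto simp: states_def tower_def PiE_def Pi_def extensional_def
      intro!: bexI[of _ "Suc n"])

section \<open>Reachability within a cost bound\<close>

text \<open>With an upper bound in place of the exact cost, staying put may be charged any
  nonnegative amount. Moves of the largest disc can thus be kept in the account of the smaller
  ones.\<close>

definition reachable ::
    "(nat \<Rightarrow> nat \<Rightarrow> real) \<Rightarrow> nat \<Rightarrow> (nat \<Rightarrow> nat) \<Rightarrow> (nat \<Rightarrow> nat) \<Rightarrow> real \<Rightarrow> bool" where
  "reachable w n s t c \<longleftrightarrow> (\<exists>ms. legal_moves n s ms t \<and> cost w ms \<le> c)"

lemma cost_simps [simp]:
  "cost w [] = 0" "cost w ((a, b) # ms) = w a b + cost w ms" "cost w (xs @ ys) = cost w xs + cost w ys"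
  by (auto simp: cost_def)

lemma legal_moves_append:
  "legal_moves n s xs u \<Longrightarrow> legal_moves n u ys t \<Longrightarrow> legal_moves n s (xs @ ys) t"
  by (induction n s xs u rule: legal_moves.induct) auto

lemma reachable_refl: "0 \<le> c \<Longrightarrow> reachable w n s s c"
  unfolding reachable_def by (auto intro: exI[of _ "[]"])

lemma reachable_trans:
  assumes "reachable w n s u c" "reachable w n u t c'"
  shows "reachable w n s t (c + c')"
  using assms unfolding reachable_def by (force intro: legal_moves_append)

lemma reachable_move: "legal_move n s a b s' \<Longrightarrow> reachable w n s s' (w a b)"
  unfolding reachable_def by (auto intro: exI[of _ "[(a, b)]"])

text \<open>The same list of moves serves, since the added disc obstructs nothing and moves name
  only pegs.\<close>

lemma reachable_lift:
  assumes "reachable w n s t c" "p \<in> pegs"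
  shows "reachable w (Suc n) (s(Suc n := p)) (t(Suc n := p)) c"
proof -
  obtain ms where ms: "legal_moves n s ms t" "cost w ms \<le> c"
    using assms by (auto simp: reachable_def)
  have "legal_moves (Suc n) (s(Suc n := p)) ms (t(Suc n := p))"
    using ms(1)
    by (induction n s ms t rule: legal_moves.induct) (auto, use assms(2) legal_move_lift in blast)
  then show ?thesis
    using ms by (auto simp: reachable_def)
qed

section \<open>Upper bound: realising both itineraries\<close>

lemma reachable_tower_direct:
  assumes "i \<in> pegs" "j \<in> pegs" "k \<in> pegs" "i \<noteq> j" "k \<noteq> i" "k \<noteq> j"
    and "reachable w n (tower n i) (tower n k) c1" "reachable w n (tower n k) (tower n j) c2"
  shows "reachable w (Suc n) (tower (Suc n) i) (tower (Suc n) j) (c1 + c2 + w i j)"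
proof -
  note [trans] = reachable_trans
  have "reachable w (Suc n) ((tower n i)(Suc n := i)) ((tower n k)(Suc n := i)) c1"
    using assms by (intro reachable_lift)
  also have "reachable w (Suc n) ((tower n k)(Suc n := i)) ((tower n k)(Suc n := j)) (w i j)"
    using assms by (intro reachable_move legal_move_largest) auto
  also have "reachable w (Suc n) ((tower n k)(Suc n := j)) ((tower n j)(Suc n := j)) c2"
    using assms by (intro reachable_lift)
  finally show ?thesis
    unfolding tower_Suc by (simp add: algebra_simps)
qed

lemma reachable_tower_detour:
  assumes "i \<in> pegs" "j \<in> pegs" "k \<in> pegs" "i \<noteq> j" "k \<noteq> i" "k \<noteq> j"
    and "reachable w n (tower n i) (tower n j) c1" "reachable w n (tower n j) (tower n i) c2"
  shows "reachable w (Suc n) (tower (Suc n) i) (tower (Suc n) j) (2 * c1 + c2 + w i k + w k j)"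
proof -
  note [trans] = reachable_trans
  have "reachable w (Suc n) ((tower n i)(Suc n := i)) ((tower n j)(Suc n := i)) c1"
    using assms by (intro reachable_lift)
  also have "reachable w (Suc n) ((tower n j)(Suc n := i)) ((tower n j)(Suc n := k)) (w i k)"
    using assms by (intro reachable_move legal_move_largest) auto
  also have "reachable w (Suc n) ((tower n j)(Suc n := k)) ((tower n i)(Suc n := k)) c2"
    using assms by (intro reachable_lift)
  also have "reachable w (Suc n) ((tower n i)(Suc n := k)) ((tower n i)(Suc n := j)) (w k j)"
    using assms by (intro reachable_move legal_move_largest) auto
  \<comment> \<open>The first passage of the smaller discs is repeated, hence the factor 2.\<close>
  also have "reachable w (Suc n) ((tower n i)(Suc n := j)) ((tower n j)(Suc n := j)) c1"
    using assms by (intro reachable_lift)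
  finally show ?thesis
    unfolding tower_Suc by (simp add: algebra_simps)
qed

section \<open>Lower bound: extracting an itinerary from any solution\<close>

text \<open>Moves of the largest disc become pauses of the others, charged with their nonnegative
  cost.\<close>

lemma reachable_restrict:
  assumes nonneg: "\<And>a b. a \<in> pegs \<Longrightarrow> b \<in> pegs \<Longrightarrow> a \<noteq> b \<Longrightarrow> 0 \<le> w a b"
    and "legal_moves (Suc n) s ms t"
  shows "reachable w n (restrict s {1..n}) (restrict t {1..n}) (cost w ms)"
  using assms(2)
proof (induction ms arbitrary: s)
  case Nil
  then show ?case
    by (simp add: reachable_refl)
next
  case (Cons m ms)
  obtain a b where m: "m = (a, b)"
    by fastforce
  with Cons obtain s' where s': "legal_move (Suc n) s a b s'" "legal_moves (Suc n) s' ms t"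
    by auto
  note IH = Cons.IH[OF s'(2)]
  from s'(1) show ?case
  proof (cases rule: legal_move_Suc_cases)
    case small
    then show ?thesis
      unfolding m cost_simps by (intro reachable_trans[OF reachable_move IH])
  next
    case (large c)
    have "0 \<le> w a b"
      using s'(1) nonneg by (auto simp: legal_move_def)
    then show ?thesis
      using reachable_trans[OF reachable_refl IH] large(6,7) unfolding m cost_simps by metis
  qed
qed

text \<open>A certificate that \<open>c\<close> pays for the itinerary of the smaller discs around
  one move of the largest. The endpoints \<open>s\<close> and \<open>t\<close> are arbitrary so that
  it can be carried through an induction on the moves.\<close>

definition direct_bound where
  "direct_bound w n i j k s t c \<longleftrightarrow> (\<exists>c1 c2. reachable w n s (tower n k) c1 \<and>
     reachable w n (tower n k) t c2 \<and> c1 + c2 + w i j \<le> c)"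

definition detour_bound where
  "detour_bound w n i j k s t c \<longleftrightarrow> (\<exists>c1 c2 c3. reachable w n s (tower n j) c1 \<and>
     reachable w n (tower n j) (tower n i) c2 \<and> reachable w n (tower n i) t c3 \<and>
     c1 + c2 + c3 + w i k + w k j \<le> c)"

lemma direct_bound_prepend:
  assumes "reachable w n s u c" "direct_bound w n i j k u t c'"
  shows "direct_bound w n i j k s t (c + c')"
proof -
  obtain c1 c2 where c: "reachable w n u (tower n k) c1" "reachable w n (tower n k) t c2"
    "c1 + c2 + w i j \<le> c'"
    using assms(2) unfolding direct_bound_def by blast
  show ?thesis
    unfolding direct_bound_def
    by (rule exI[of _ "c + c1"], rule exI[of _ c2]) (use c reachable_trans[OF assms(1) c(1)] in auto)
qed

lemma detour_bound_prepend:
  assumes "reachable w n s u c" "detour_bound w n i j k u t c'"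
  shows "detour_bound w n i j k s t (c + c')"
proof -
  obtain c1 c2 c3 where c: "reachable w n u (tower n j) c1"
    "reachable w n (tower n j) (tower n i) c2" "reachable w n (tower n i) t c3"
    "c1 + c2 + c3 + w i k + w k j \<le> c'"
    using assms(2) unfolding detour_bound_def by blast
  show ?thesis
    unfolding detour_bound_def
    by (rule exI[of _ "c + c1"], rule exI[of _ c2], rule exI[of _ c3])
      (use c reachable_trans[OF assms(1) c(1)] in auto)
qed

text \<open>The itinerary starting with the largest disc on \<open>k\<close> is needed to carry the induction past a
  move of that disc from \<open>i\<close> to \<open>k\<close>; its extra alternative, a direct move from \<open>k\<close> to \<open>j\<close>, is then
  the second half of a detour.\<close>

lemma legal_moves_bounds:
  assumes nonneg: "\<And>a b. a \<in> pegs \<Longrightarrow> b \<in> pegs \<Longrightarrow> a \<noteq> b \<Longrightarrow> 0 \<le> w a b"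
    and pegs: "pegs = {i, j, k}" "i \<noteq> j" "k \<noteq> i" "k \<noteq> j"
    and moves: "legal_moves (Suc n) s ms t" "t (Suc n) = j"
  defines "r \<equiv> \<lambda>s. restrict s {1..n}"
  shows "s (Suc n) = i \<Longrightarrow> direct_bound w n i j k (r s) (r t) (cost w ms) \<or>
           detour_bound w n i j k (r s) (r t) (cost w ms)"
    and "s (Suc n) = k \<Longrightarrow> direct_bound w n i j k (r s) (r t) (cost w ms) \<or>
           detour_bound w n i j k (r s) (r t) (cost w ms) \<or>
           direct_bound w n k j i (r s) (r t) (cost w ms)"
proof -
  have "(s (Suc n) = i \<longrightarrow> direct_bound w n i j k (r s) (r t) (cost w ms) \<or>
           detour_bound w n i j k (r s) (r t) (cost w ms)) \<and>
        (s (Suc n) = k \<longrightarrow> direct_bound w n i j k (r s) (r t) (cost w ms) \<or>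
           detour_bound w n i j k (r s) (r t) (cost w ms) \<or>
           direct_bound w n k j i (r s) (r t) (cost w ms))"
    using moves(1)
  proof (induction ms arbitrary: s)
    case Nil
    \<comment> \<open>Vacuous: the largest disc ends on \<open>j\<close>, hence starts on neither
      \<open>i\<close> nor \<open>k\<close>.\<close>
    then show ?case
      using moves(2) pegs by auto
  next
    case (Cons m ms)
    obtain a b where m: "m = (a, b)"
      by fastforce
    with Cons obtain s' where s': "legal_move (Suc n) s a b s'" "legal_moves (Suc n) s' ms t"
      by auto
    note IH = Cons.IH[OF s'(2)]
    from s'(1) show ?case
    proof (cases rule: legal_move_Suc_cases)
      case small
      have "reachable w n (r s) (r s') (w a b)"
        unfolding r_def using small(2) by (rule reachable_move)
      then show ?thesis
        using IH small(1) direct_bound_prepend detour_bound_prepend m by fastforce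
    next
      case (large c)
      have "0 \<le> w a b"
        using s'(1) nonneg by (auto simp: legal_move_def)
      then have stay: "reachable w n (r s) (r s') (w a b)"
        using large(6,7) by (simp only: r_def reachable_refl)
      have rest: "reachable w n (r s') (r t) (cost w ms)"
        unfolding r_def using nonneg s'(2) by (rule reachable_restrict)
      \<comment> \<open>The smaller discs already form the tower on \<open>c\<close>, so the first
        segment is free and the remaining moves give the second.\<close>
      have direct: "direct_bound w n a b c (r s) (r t) (cost w (m # ms))"
        unfolding direct_bound_def
        by (rule exI[of _ 0], rule exI[of _ "cost w ms"])
          (use rest large reachable_refl m in \<open>auto simp: r_def\<close>)
      \<comment> \<open>Moves into \<open>j\<close> are settled by \<open>direct\<close>; a move
        from \<open>k\<close> to \<open>i\<close> falls back on the induction hypothesis for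
        \<open>i\<close>; \<open>a = j\<close> is vacuous.\<close>
      consider "a = i" "b = j" "c = k" | "a = k" "b = j" "c = i" | "a = k" "b = i" | "a = j"
        | "a = i" "b = k" "c = j"
      proof -
        have "{a, b, c} = {i, j, k}" "a \<noteq> b"
          using large(3) pegs(1) s'(1) by (auto simp: legal_move_def)
        then have "a \<in> {i, j, k}" "b \<in> {i, j, k}" "c \<in> {i, j, k}" "a \<noteq> b"
          by blast+
        then show thesis
          using large(4,5) that by blast
      qed
      then show ?thesis
      proof cases
        case 5
        \<comment> \<open>Here \<open>c = j\<close>: the smaller discs stand on \<open>j\<close>
          when the largest leaves \<open>i\<close>, so the first segment of the detour costs
          0.\<close>
        have "detour_bound w n i j k (r s) (r t) (cost w (m # ms))"
          if D: "direct_bound w n k j i (r s') (r t) (cost w ms)"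
        proof -
          obtain c1 c2 where "reachable w n (r s') (tower n i) c1"
            "reachable w n (tower n i) (r t) c2" "c1 + c2 + w k j \<le> cost w ms"
            using D unfolding direct_bound_def by blast
          then show ?thesis
            unfolding detour_bound_def
            by (intro exI[of _ 0] exI[of _ c1] exI[of _ c2])
              (use 5 large m reachable_refl in \<open>auto simp: r_def\<close>)
        qed
        then show ?thesis
          using IH 5 large(1,2) pegs m direct_bound_prepend[OF stay] detour_bound_prepend[OF stay]
          by auto
      qed (use IH large(1,2) direct pegs m direct_bound_prepend[OF stay]
          detour_bound_prepend[OF stay] in auto)
    qed
  qed
  then show "s (Suc n) = i \<Longrightarrow> direct_bound w n i j k (r s) (r t) (cost w ms) \<or>
           detour_bound w n i j k (r s) (r t) (cost w ms)"
    and "s (Suc n) = k \<Longrightarrow> direct_bound w n i j k (r s) (r t) (cost w ms) \<or>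
           detour_bound w n i j k (r s) (r t) (cost w ms) \<or>
           direct_bound w n k j i (r s) (r t) (cost w ms)"
    by auto
qed

section \<open>The recursion and existence of optimal solutions\<close>

text \<open>The cheaper itinerary meets a lower bound valid for every solution, so existence and
  value come together. Assuming optima for \<open>n\<close> discs between all pairs of pegs makes
  \<open>C\<close> a genuine minimum and fits an induction on \<open>n\<close>.\<close>

lemma optimal_solution_step:
  assumes nonneg: "\<And>a b. a \<in> pegs \<Longrightarrow> b \<in> pegs \<Longrightarrow> a \<noteq> b \<Longrightarrow> 0 \<le> w a b"
    and pegs: "pegs = {i, j, k}" "i \<noteq> j" "k \<noteq> i" "k \<noteq> j"
    and optimal: "\<And>a b. a \<in> pegs \<Longrightarrow> b \<in> pegs \<Longrightarrow> a \<noteq> b \<Longrightarrow> \<exists>ms. optimal_solution w n a b ms"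
  defines "C \<equiv> opt_cost w n"
  shows "\<exists>ms. optimal_solution w (Suc n) i j ms \<and>
    cost w ms = min (C i k + C k j + w i j) (2 * C i j + C j i + w i k + w k j)"
    (is "\<exists>ms. _ \<and> _ = ?M")
proof -
  have C: "reachable w n (tower n a) (tower n b) (C a b) \<and>
      (\<forall>c. reachable w n (tower n a) (tower n b) c \<longrightarrow> C a b \<le> c)"
    if ab: "a \<in> pegs" "b \<in> pegs" "a \<noteq> b" for a b
  proof -
    obtain ms where ms: "optimal_solution w n a b ms"
      using optimal[OF ab] by blast
    then have "C a b = cost w ms"
      unfolding C_def by (rule opt_cost_eqI)
    then show ?thesis
      using ms unfolding optimal_solution_def solution_def reachable_def by fastforce
  qed
  have "reachable w (Suc n) (tower (Suc n) i) (tower (Suc n) j) (C i k + C k j + w i j)"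
    using pegs C by (intro reachable_tower_direct[of i j k]) auto
  moreover have "reachable w (Suc n) (tower (Suc n) i) (tower (Suc n) j)
      (2 * C i j + C j i + w i k + w k j)"
    using pegs C by (intro reachable_tower_detour[of i j k]) auto
  ultimately have "reachable w (Suc n) (tower (Suc n) i) (tower (Suc n) j) ?M"
    by (auto simp: min_def)
  then obtain ms where ms: "solution (Suc n) i j ms" "cost w ms \<le> ?M"
    by (auto simp: reachable_def solution_def)
  have lower: "?M \<le> cost w ms'" if "solution (Suc n) i j ms'" for ms'
  proof -
    have "direct_bound w n i j k (tower n i) (tower n j) (cost w ms') \<or>
        detour_bound w n i j k (tower n i) (tower n j) (cost w ms')"
      using legal_moves_bounds(1)[OF nonneg pegs that[unfolded solution_def]]
      unfolding restrict_tower_Suc by (simp add: tower_Suc)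
    then show ?thesis
    proof
      assume "direct_bound w n i j k (tower n i) (tower n j) (cost w ms')"
      then obtain c1 c2 where "reachable w n (tower n i) (tower n k) c1"
        "reachable w n (tower n k) (tower n j) c2" "c1 + c2 + w i j \<le> cost w ms'"
        unfolding direct_bound_def by blast
      moreover from this have "C i k \<le> c1" "C k j \<le> c2"
        using C pegs by auto
      ultimately show ?thesis
        by linarith
    next
      assume "detour_bound w n i j k (tower n i) (tower n j) (cost w ms')"
      then obtain c1 c2 c3 where "reachable w n (tower n i) (tower n j) c1"
        "reachable w n (tower n j) (tower n i) c2" "reachable w n (tower n i) (tower n j) c3"
        "c1 + c2 + c3 + w i k + w k j \<le> cost w ms'"
        unfolding detour_bound_def by blast
      moreover from this have "C i j \<le> c1" "C j i \<le> c2" "C i j \<le> c3"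
        using C pegs by auto
      ultimately show ?thesis
        by linarith
    qed
  qed
  then show ?thesis
    using ms unfolding optimal_solution_def by (intro exI[of _ ms]) force
qed

lemma optimal_solution_exists:
  assumes nonneg: "\<And>a b. a \<in> pegs \<Longrightarrow> b \<in> pegs \<Longrightarrow> a \<noteq> b \<Longrightarrow> 0 \<le> w a b"
    and "i \<in> pegs" "j \<in> pegs" "i \<noteq> j"
  shows "\<exists>ms. optimal_solution w n i j ms"
  using assms(2-)
proof (induction n arbitrary: i j)
  case 0
  \<comment> \<open>Without discs both towers are the same function, and no cost is
    negative.\<close>
  have "optimal_solution w 0 i j []"
    using cost_nonneg[of w] nonneg
    by (auto simp: optimal_solution_def solution_def tower_def)
  then show ?case
    by blast
next
  case (Suc n)
  note k = third_peg[OF Suc.prems refl]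
  show ?case
    using optimal_solution_step[where w = w, OF nonneg k(1) Suc.prems(3) k(2,3) Suc.IH] by blast
qed

theorem theorem1:
  fixes w :: "nat \<Rightarrow> nat \<Rightarrow> real" and n i j k :: nat
  assumes "\<And>a b. a \<in> pegs \<Longrightarrow> b \<in> pegs \<Longrightarrow> a \<noteq> b \<Longrightarrow> 0 \<le> w a b"
    and "i \<in> pegs" and "j \<in> pegs" and "i \<noteq> j"
    and "k = 6 - i - j"
    and "n \<ge> 1"
  shows "opt_cost w n i j =
    (if n = 1 then min (w i j) (w i k + w k j)
     else min (opt_cost w (n - 1) i k + opt_cost w (n - 1) k j + w i j)
              (2 * opt_cost w (n - 1) i j + opt_cost w (n - 1) j i + w i k + w k j))"
proof -
  note k = third_peg[OF assms(2-5)]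
  obtain m where m: "n = Suc m"
    using assms(6) by (cases n) auto
  obtain ms where "optimal_solution w (Suc m) i j ms"
    "cost w ms = min (opt_cost w m i k + opt_cost w m k j + w i j)
       (2 * opt_cost w m i j + opt_cost w m j i + w i k + w k j)"
    using optimal_solution_step[where w = w, OF assms(1) k(1) assms(4) k(2,3)
        optimal_solution_exists[where w = w, OF assms(1)]]
    by blast
  then have "opt_cost w n i j = min (opt_cost w m i k + opt_cost w m k j + w i j)
       (2 * opt_cost w m i j + opt_cost w m j i + w i k + w k j)"
    using m opt_cost_eqI by metis
  \<comment> \<open>For \<open>n = 1\<close> the general recursion at \<open>m = 0\<close> collapses
    to the stated special case.\<close>
  moreover have "opt_cost w 0 a b = 0" for a b
    using assms(1) by (rule opt_cost_0)
  ultimately show ?thesis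
    using m by (cases m) auto
qed

end
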